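(* Let $P$ be a finite lattice and let $M=\mathcal{F}(P)$ be the monoid of all regressive, order-preserving, $1$-level-Lipschitz functions $f:P\to P$, under function composition (with $(fg)(p)=f(g(p))$). Then $X(M)$ is linear if and only if $P$ is a chain of length $1$, $2$ or $3$.
   Context: A function $f:P\to P$ on a poset is regressive if $f(p)\leq p$ for all $p\in P$, and order-preserving if $x\leq y$ implies $f(x)\leq f(y)$. The length of a chain is its number of elements. For $x$ in a finite poset $P$, $\operatorname{level}(x)$ is the maximal length of a chain in $P$ whose maximal element is $x$ (so minimal elements have level $1$). A function $f:P\to P$ is $k$-level-Lipschitz if whenever $x>y$ and $\operatorname{level}(x)=\operatorname{level}(y)+1$, then $|\operatorname{level}(f(x))-\operatorname{level}(f(y))|\leq k$. Finite lattices are nonempty (they have a minimum and a maximum). For a monoid $M$ and $m\in M$, put $mM=\{mx : x\in M\}$. $X(M)=\{mM : m\in M\}$ is viewed as a poset ordered by inclusion; it is linear if any two of its elements are comparable under $\subseteq$. Product convention: $(fg)(p)=f(g(p))$, so $fM=\{f\circ h : h\in M\}$. *)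

theory Defs
  imports "HOL-Algebra.Group"
begin

definition regressive :: "('a::order \<Rightarrow> 'a) \<Rightarrow> bool" where
  "regressive f \<longleftrightarrow> (\<forall>p. f p \<le> p)"

text \<open>The length of a chain is its number of elements. The set below is finite and contains 1
  (from the chain \<open>{x}\<close>), so \<open>Max\<close> is meaningful.\<close>

definition level :: "'a::{finite, order} \<Rightarrow> nat" where
  "level x = Max {card C |C. Complete_Partial_Order.chain (\<le>) C \<and> x \<in> C \<and> (\<forall>y\<in>C. y \<le> x)}"

definition level_Lipschitz :: "nat \<Rightarrow> ('a::{finite, order} \<Rightarrow> 'a) \<Rightarrow> bool" where
  "level_Lipschitz k f \<longleftrightarrow>
    (\<forall>x y. x > y \<and> level x = level y + 1 \<longrightarrow>
      \<bar>int (level (f x)) - int (level (f y))\<bar> \<le> int k)"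

definition F_monoid :: "('a::{finite, order} \<Rightarrow> 'a) monoid" where
  "F_monoid = \<lparr>carrier = {f. regressive f \<and> mono f \<and> level_Lipschitz 1 f},
               mult = (\<circ>), one = id\<rparr>"

definition principal_right :: "('m, 'r) monoid_scheme \<Rightarrow> 'm \<Rightarrow> 'm set" where
  "principal_right M m = {m \<otimes>\<^bsub>M\<^esub> x |x. x \<in> carrier M}"

definition X_poset :: "('m, 'r) monoid_scheme \<Rightarrow> 'm set set" where
  "X_poset M = {principal_right M m |m. m \<in> carrier M}"

lemma level_strict_mono:
  fixes x y :: "'a::{finite, order}"
  assumes "y < x"
  shows "level y < level x"
proof -
  let ?S = "\<lambda>x::'a. {card C |C. Complete_Partial_Order.chain (\<le>) C \<and> x \<in> C \<and> (\<forall>y\<in>C. y \<le> x)}"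
  have fin: "finite (?S z)" for z
    by (rule finite_subset[of _ "card ` UNIV"]) auto
  have "card {y} \<in> ?S y"
    by (auto simp: Complete_Partial_Order.chain_def intro!: exI[of _ "{y}"])
  then have "level y \<in> ?S y"
    unfolding level_def using Max_in[OF fin] by blast
  then obtain C where C: "level y = card C" "Complete_Partial_Order.chain (\<le>) C"
      "y \<in> C" "\<forall>z\<in>C. z \<le> y"
    by blast
  have le: "z \<le> x" if "z \<in> C" for z
    using C(4) that assms by (meson order.trans order.strict_implies_order)
  have "x \<notin> C" using C(4) assms by (meson leD)
  then have "card (insert x C) = Suc (level y)" using C(1) by simp
  moreover have "Complete_Partial_Order.chain (\<le>) (insert x C)"
    using C(2) le by (auto simp: Complete_Partial_Order.chain_def)
  ultimately have "Suc (level y) \<in> ?S x"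
    using le by (intro CollectI exI[of _ "insert x C"]) auto
  then show ?thesis
    unfolding level_def[of x] using Max_ge[OF fin] by (meson Suc_le_lessD)
qed

lemma monoid_F_monoid: "Group.monoid (F_monoid :: ('a::{finite, order} \<Rightarrow> 'a) monoid)"
proof
  fix f g :: "'a \<Rightarrow> 'a"
  assume "f \<in> carrier F_monoid" "g \<in> carrier F_monoid"
  then have f: "regressive f" "mono f" "level_Lipschitz 1 f"
    and g: "regressive g" "mono g" "level_Lipschitz 1 g"
    by (auto simp: F_monoid_def)
  have "regressive (f \<circ> g)"
    using f(1) g(1) by (auto simp: regressive_def intro: order_trans)
  moreover have "mono (f \<circ> g)"
    using f(2) g(2) by (auto simp: mono_def)
  moreover have "level_Lipschitz 1 (f \<circ> g)"
    unfolding level_Lipschitz_def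
  proof (intro allI impI)
    fix x y :: 'a
    assume xy: "x > y \<and> level x = level y + 1"
    then have "g y \<le> g x" using g(2) by (auto simp: mono_def)
    moreover have "\<bar>int (level (g x)) - int (level (g y))\<bar> \<le> 1"
      using g(3) xy by (auto simp: level_Lipschitz_def)
    ultimately have "g y = g x \<or> (g x > g y \<and> level (g x) = level (g y) + 1)"
      using level_strict_mono[of "g y" "g x"] by (auto simp: order.order_iff_strict)
    then show "\<bar>int (level ((f \<circ> g) x)) - int (level ((f \<circ> g) y))\<bar> \<le> int 1"
      using f(3) by (auto simp: level_Lipschitz_def)
  qed
  ultimately show "f \<otimes>\<^bsub>F_monoid\<^esub> g \<in> carrier F_monoid"
    by (simp add: F_monoid_def)
qed (auto simp: F_monoid_def regressive_def mono_def level_Lipschitz_def)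

end

theory Submission
  imports Defs
begin

text \<open>
  Linearity of \<open>X(M)\<close> means that of any two \<open>f, g \<in> M\<close> one lies in the principal right ideal of the
  other; membership \<open>f \<in> gM\<close> forces the image of \<open>f\<close> into the image of \<open>g\<close>.

  If \<open>P\<close> is not a chain, let \<open>w\<close> be a minimal element with two distinct upper covers \<open>b\<close> and \<open>b'\<close>.
  Minimality makes every element comparable to \<open>w\<close>, so the maps \<open>x \<mapsto> x \<sqinter> b\<close> and \<open>x \<mapsto> x \<sqinter> b'\<close> are
  \<open>1\<close>-level-Lipschitz, and their images are the incomparable principal ideals below \<open>b\<close> and \<open>b'\<close>.
  If \<open>P\<close> is a chain beginning with \<open>o < a < b < d\<close>, the map sending \<open>o, a\<close> to \<open>o\<close>, \<open>b\<close> to \<open>a\<close> and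
  everything else to \<open>b\<close> is incomparable with \<open>x \<mapsto> x \<sqinter> a\<close>: the first image contains \<open>b\<close>, while
  precomposing the first map with a regressive map always sends \<open>a\<close> to \<open>o\<close>.
  If \<open>P\<close> is a chain with at most three elements, then \<open>f = g\<close>, \<open>g \<circ> f = f\<close> or \<open>f \<circ> g = g\<close>
  for all \<open>f, g \<in> M\<close>.
\<close>

section \<open>Principal right ideals and membership in the monoid\<close>

lemma (in Group.monoid) principal_right_subset_iff:
  assumes "m \<in> carrier G" "n \<in> carrier G"
  shows "principal_right G m \<subseteq> principal_right G n \<longleftrightarrow> m \<in> principal_right G n"
proof
  assume "principal_right G m \<subseteq> principal_right G n"
  moreover have "m \<in> principal_right G m"
    using assms by (auto simp: principal_right_def intro!: exI[of _ "\<one>"])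
  ultimately show "m \<in> principal_right G n" by blast
next
  assume "m \<in> principal_right G n"
  then obtain x where "x \<in> carrier G" "m = n \<otimes> x"
    by (auto simp: principal_right_def)
  then show "principal_right G m \<subseteq> principal_right G n"
    using assms by (auto simp: principal_right_def m_assoc)
qed

lemma (in Group.monoid) chain_X_poset_iff:
  "Complete_Partial_Order.chain (\<subseteq>) (X_poset G) \<longleftrightarrow>
    (\<forall>m\<in>carrier G. \<forall>n\<in>carrier G. m \<in> principal_right G n \<or> n \<in> principal_right G m)"
proof -
  have "Complete_Partial_Order.chain (\<subseteq>) (X_poset G) \<longleftrightarrow>
    (\<forall>m\<in>carrier G. \<forall>n\<in>carrier G. principal_right G m \<subseteq> principal_right G n \<or>
      principal_right G n \<subseteq> principal_right G m)"
    by (auto simp: X_poset_def Complete_Partial_Order.chain_def)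
  then show ?thesis by (simp add: principal_right_subset_iff)
qed

lemma mem_principal_right_F_monoid_iff:
  "f \<in> principal_right F_monoid g \<longleftrightarrow> (\<exists>h\<in>carrier F_monoid. f = g \<circ> h)"
  by (auto simp: principal_right_def F_monoid_def)

lemma mem_carrier_F_monoid_iff:
  fixes f :: "'a::{finite, order} \<Rightarrow> 'a"
  shows "f \<in> carrier F_monoid \<longleftrightarrow> regressive f \<and> mono f \<and>
    (\<forall>x y. y < x \<longrightarrow> level x = level y + 1 \<longrightarrow> level (f x) \<le> level (f y) + 1)"
proof -
  have "level (f y) \<le> level (f x)" if "mono f" "y < x" for x y
    using that level_strict_mono[of "f y" "f x"] monoD[of f y x]
    by (auto simp: order.order_iff_strict)
  then show ?thesis
    unfolding F_monoid_def level_Lipschitz_def by fastforce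
qed

text \<open>In a longest chain with top \<open>b\<close>, everything except \<open>b\<close> lies
  below \<open>w\<close>; replacing \<open>b\<close> by \<open>w\<close> gives a chain with top
  \<open>w\<close> that is at most one element shorter.\<close>

lemma level_le_Suc_level:
  fixes b w :: "'a::{finite, order}"
  assumes "\<And>z. z < b \<Longrightarrow> z \<le> w"
  shows "level b \<le> level w + 1"
proof -
  let ?S = "\<lambda>x::'a. {card C |C. Complete_Partial_Order.chain (\<le>) C \<and> x \<in> C \<and> (\<forall>y\<in>C. y \<le> x)}"
  have fin: "finite (?S z)" for z
    by (rule finite_subset[of _ "card ` UNIV"]) auto
  have "card {b} \<in> ?S b"
    by (auto simp: Complete_Partial_Order.chain_def intro!: exI[of _ "{b}"])
  then have "level b \<in> ?S b"
    unfolding level_def using Max_in[OF fin] by blast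
  then obtain C where C: "level b = card C" "Complete_Partial_Order.chain (\<le>) C"
      "b \<in> C" "\<forall>z\<in>C. z \<le> b"
    by blast
  let ?D = "insert w (C - {b})"
  have le: "z \<le> w" if "z \<in> C - {b}" for z
    using that C(4) assms by (auto simp: order.order_iff_strict)
  have "Complete_Partial_Order.chain (\<le>) ?D"
    using C(2) le by (auto simp: Complete_Partial_Order.chain_def)
  then have "card ?D \<in> ?S w"
    using le by (intro CollectI exI[of _ ?D]) auto
  then have "card ?D \<le> level w"
    unfolding level_def[of w] using Max_ge[OF fin] by blast
  \<comment> \<open>Only an inequality, since \<open>w\<close> may already belong to
    \<open>C - {b}\<close>.\<close>
  moreover have "card (C - {b}) \<le> card ?D" by (rule card_mono) auto
  moreover have "card (C - {b}) = card C - 1" using C(3) by simp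
  ultimately show ?thesis using C(1) by simp
qed

section \<open>Covers and lattices that are not chains\<close>

definition covered_by :: "'a::order \<Rightarrow> 'a \<Rightarrow> bool" where
  "covered_by w b \<longleftrightarrow> w < b \<and> (\<forall>z. w < z \<longrightarrow> z \<le> b \<longrightarrow> z = b)"

lemma covered_by_exists:
  fixes w x :: "'a::{finite, order}"
  assumes "w < x"
  obtains b where "covered_by w b" "b \<le> x"
proof -
  obtain b where "b \<in> {c. w < c \<and> c \<le> x}" "\<forall>c\<in>{c. w < c \<and> c \<le> x}. c \<le> b \<longrightarrow> b = c"
    using finite_has_minimal[of "{c. w < c \<and> c \<le> x}"] assms by auto
  then have "covered_by w b" "b \<le> x"
    by (auto simp: covered_by_def intro: order_trans)
  then show thesis by (rule that)
qed

lemma inf_two_covers: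
  fixes x y :: "'a::{finite, lattice}"
  assumes "\<not> x \<le> y" "\<not> y \<le> x"
  shows "\<exists>b b'. covered_by (inf x y) b \<and> covered_by (inf x y) b' \<and> b \<noteq> b'"
proof -
  have "inf x y < x" "inf x y < y"
    using assms by (metis inf.cobounded1 inf.cobounded2 order.not_eq_order_implies_strict)+
  then obtain b b' where b: "covered_by (inf x y) b" "b \<le> x"
    and b': "covered_by (inf x y) b'" "b' \<le> y"
    by (meson covered_by_exists)
  \<comment> \<open>A common cover would be a lower bound of \<open>x\<close> and \<open>y\<close>
    strictly above their infimum.\<close>
  have "b \<noteq> b'"
    using b b' by (metis covered_by_def le_inf_iff leD)
  then show ?thesis using b b' by blast
qed

text \<open>Comparability with \<open>w\<close> splits the lattice in two: the map is the identity
  below \<open>w\<close> and takes only the values \<open>w\<close> and \<open>b\<close> above it,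
  and the levels of these two differ by one.\<close>

lemma inf_cover_in_F_monoid:
  fixes w b :: "'a::{finite, lattice}"
  assumes comp: "\<And>x. x \<le> w \<or> w \<le> x" and cov: "covered_by w b"
  shows "(\<lambda>x. inf x b) \<in> carrier F_monoid"
proof -
  have wb: "w < b" and mid: "\<And>z. w < z \<Longrightarrow> z \<le> b \<Longrightarrow> z = b"
    using cov by (auto simp: covered_by_def)
  have lev_b: "level b \<le> level w + 1"
  proof (rule level_le_Suc_level)
    show "z \<le> w" if "z < b" for z
      using that comp[of z] mid[of z] by (auto simp: order.order_iff_strict)
  qed
  have below: "inf x b = x" if "x \<le> w" for x
    using that wb by (simp add: inf_absorb1 order.strict_implies_order)
  have above: "inf x b = w \<or> inf x b = b \<and> b \<le> x" if "w \<le> x" for x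
    using that wb mid[of "inf x b"]
    by (metis inf.bounded_iff inf.cobounded2 inf.orderE order.order_iff_strict)
  have "level (inf x b) \<le> level (inf y b) + 1" if xy: "y < x" "level x = level y + 1" for x y
  proof (cases "w \<le> y")
    case True
    then show ?thesis
      using above[of y] above[of x] lev_b xy(1) level_strict_mono[OF wb]
      by (metis le_add1 nle_le order.trans order.strict_implies_order)
  next
    case False
    then have yw: "y < w" "inf y b = y" using comp[of y] below[of y] by auto
    show ?thesis
    proof (cases "x \<le> w")
      case True
      then show ?thesis using below[of x] yw xy by simp
    next
      case False
      then have wx: "w < x" using comp[of x] by auto
      \<comment> \<open>This case is void: \<open>y < w < x\<close> forces the levels of
        \<open>x\<close> and \<open>y\<close> to differ by at least two.\<close>
      then show ?thesis
        using level_strict_mono[OF yw(1)] level_strict_mono[OF wx] xy(2) by simp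
    qed
  qed
  moreover have "mono (\<lambda>x. inf x b)"
    by (auto intro: monoI inf_mono)
  ultimately show ?thesis
    by (simp add: mem_carrier_F_monoid_iff regressive_def)
qed

lemma not_chain_imp_incomparable:
  assumes "\<not> Complete_Partial_Order.chain (\<le>) (UNIV :: 'a::{finite, lattice} set)"
  shows "\<exists>f\<in>carrier F_monoid. \<exists>g\<in>carrier F_monoid.
    \<not> range f \<subseteq> range g \<and> \<not> range g \<subseteq> range (f :: 'a \<Rightarrow> 'a)"
proof -
  let ?W = "{w::'a. \<exists>b b'. covered_by w b \<and> covered_by w b' \<and> b \<noteq> b'}"
  have "?W \<noteq> {}"
    using assms inf_two_covers by (force simp: Complete_Partial_Order.chain_def)
  then obtain w where w: "w \<in> ?W" and min: "\<forall>v\<in>?W. v \<le> w \<longrightarrow> w = v"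
    using finite_has_minimal[OF finite[of ?W]] by blast
  from w obtain b b' where b: "covered_by w b" "covered_by w b'" "b \<noteq> b'" by blast
  \<comment> \<open>For \<open>x\<close> incomparable to \<open>w\<close>, the element
    \<open>inf x w\<close> would have two covers as well and lie strictly below
    \<open>w\<close>.\<close>
  have comp: "x \<le> w \<or> w \<le> x" for x
  proof (rule ccontr)
    assume x: "\<not> (x \<le> w \<or> w \<le> x)"
    then have "inf x w \<in> ?W" using inf_two_covers[of x w] by simp
    then have "w = inf x w" using min by simp
    then show False using x inf.cobounded1[of x w] by simp
  qed
  have "\<not> b \<le> b'" "\<not> b' \<le> b"
    using b by (auto simp: covered_by_def)
  moreover have "range (\<lambda>x. inf x c) = {..c}" for c :: 'a
    by (auto simp: image_iff intro: inf_absorb1[symmetric])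
  ultimately show ?thesis
    using inf_cover_in_F_monoid[OF comp b(1)] inf_cover_in_F_monoid[OF comp b(2)]
    by (intro bexI[of _ "\<lambda>x. inf x b"] bexI[of _ "\<lambda>x. inf x b'"]) auto
qed

section \<open>Long and short chains\<close>

lemma chain_least_outside:
  fixes S :: "'a::{finite, order} set"
  assumes "Complete_Partial_Order.chain (\<le>) (UNIV :: 'a set)" "card S < card (UNIV :: 'a set)"
  shows "\<exists>m. m \<notin> S \<and> (\<forall>z. z \<notin> S \<longrightarrow> m \<le> z)"
proof -
  have "- S \<noteq> {}" using assms(2) by (metis Compl_empty_eq double_compl less_irrefl)
  then obtain m where "m \<in> - S" "\<forall>c\<in>- S. c \<le> m \<longrightarrow> m = c"
    using finite_has_minimal[of "- S"] by auto
  then show ?thesis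
    using assms(1) by (intro exI[of _ m]) (auto simp: Complete_Partial_Order.chain_def)
qed

lemma long_chain_incomparable:
  assumes ch: "Complete_Partial_Order.chain (\<le>) (UNIV :: 'a::{finite, lattice} set)"
    and card: "card (UNIV :: 'a set) \<ge> 4"
  shows "\<exists>f\<in>carrier F_monoid. \<exists>g\<in>carrier F_monoid.
    (f :: 'a \<Rightarrow> 'a) \<notin> principal_right F_monoid g \<and> g \<notin> principal_right F_monoid f"
proof -
  \<comment> \<open>The three lowest elements are peeled off one by one, each being least outside
    the set of the earlier ones; of \<open>d\<close> only its being a further element
    matters.\<close>
  obtain o' :: 'a where o: "\<And>z. o' \<le> z"
    using chain_least_outside[OF ch, of "{}"] card by auto
  obtain a where a: "a \<noteq> o'" "\<And>z. z \<noteq> o' \<Longrightarrow> a \<le> z"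
    using chain_least_outside[OF ch, of "{o'}"] card by auto
  have "card {o', a} < card (UNIV :: 'a set)" using card a by auto
  then obtain b where b: "b \<noteq> o'" "b \<noteq> a" "\<And>z. z \<noteq> o' \<Longrightarrow> z \<noteq> a \<Longrightarrow> b \<le> z"
    using chain_least_outside[OF ch, of "{o', a}"] by auto
  have "card {o', a, b} < card (UNIV :: 'a set)" using card a b by auto
  then obtain d where d: "d \<noteq> o'" "d \<noteq> a" "d \<noteq> b"
    using chain_least_outside[OF ch, of "{o', a, b}"] by auto
  have lt: "o' < a" "a < b" "b < d"
    using o a b d by (auto simp: order.order_iff_strict)
  have lin: "x \<le> y \<or> y \<le> x" for x y :: 'a
    using ch by (auto simp: Complete_Partial_Order.chain_def)
  have lev: "level a \<le> level o' + 1" "level b \<le> level a + 1"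
    by (rule level_le_Suc_level; metis a(2) b(3) leD o order.refl)+
  define f where "f x = (if x \<le> a then o' else if x \<le> b then a else b)" for x
  have f: "f \<in> carrier F_monoid"
  proof -
    have "regressive f"
      using lin lt by (auto simp: regressive_def f_def o)
    moreover have "mono f"
      using lt by (auto simp: f_def o intro!: monoI dest: order_trans)
    moreover have "level (f x) \<le> level (f y) + 1" if xy: "y < x" "level x = level y + 1" for x y
    proof -
      \<comment> \<open>The only jump of \<open>f\<close> that could be too large is from
        \<open>o'\<close> to \<open>b\<close>. It would need \<open>y \<le> a\<close> and
        \<open>b < x\<close>, but then \<open>b\<close> lies strictly between \<open>y\<close> and
        \<open>x\<close>, whose levels differ by just one.\<close>
      have "x \<le> b" if "y \<le> a"
      proof (rule ccontr)
        assume "\<not> x \<le> b"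
        then have "b < x" using lin[of x b] by auto
        moreover have "y < b" using that lt by auto
        ultimately show False
          using level_strict_mono[of b x] level_strict_mono[of y b] xy(2) by simp
      qed
      then show ?thesis
        using xy(1) lev by (auto simp: f_def)
    qed
    ultimately show ?thesis by (simp add: mem_carrier_F_monoid_iff)
  qed
  have cov: "covered_by o' a"
    using lt a(2) by (auto simp: covered_by_def intro: antisym)
  have g: "(\<lambda>x. inf x a) \<in> carrier F_monoid"
    by (rule inf_cover_in_F_monoid[OF _ cov]) (simp add: o)
  have "f \<notin> principal_right F_monoid (\<lambda>x. inf x a)"
  proof
    assume "f \<in> principal_right F_monoid (\<lambda>x. inf x a)"
    then obtain h where "f = (\<lambda>x. inf x a) \<circ> h"
      by (auto simp: mem_principal_right_F_monoid_iff)
    then have "f d \<le> a" by simp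
    moreover have "f d = b" using lt by (auto simp: f_def)
    ultimately show False using lt by auto
  qed
  moreover have "(\<lambda>x. inf x a) \<notin> principal_right F_monoid f"
  proof
    assume "(\<lambda>x. inf x a) \<in> principal_right F_monoid f"
    then obtain h where h: "h \<in> carrier F_monoid" "(\<lambda>x. inf x a) = f \<circ> h"
      by (auto simp: mem_principal_right_F_monoid_iff)
    have "h a \<le> a" using h(1) by (auto simp: mem_carrier_F_monoid_iff regressive_def)
    then have "f (h a) = o'" by (simp add: f_def)
    moreover have "f (h a) = a" using fun_cong[OF h(2), of a] by simp
    ultimately show False using lt by simp
  qed
  ultimately show ?thesis using f g by blast
qed

text \<open>The equation \<open>g \<circ> f = f\<close> says that \<open>g\<close> fixes the image
  of \<open>f\<close>, and it exhibits \<open>f\<close> as a member of the right ideal of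
  \<open>g\<close> with \<open>f\<close> itself as the right factor.\<close>

lemma short_chain_absorb:
  fixes f g :: "'a::{finite, order} \<Rightarrow> 'a"
  assumes ch: "Complete_Partial_Order.chain (\<le>) (UNIV :: 'a set)"
    and card: "card (UNIV :: 'a set) \<in> {1, 2, 3}"
    and f: "f \<in> carrier F_monoid" and g: "g \<in> carrier F_monoid"
  shows "f = g \<or> g \<circ> f = f \<or> f \<circ> g = g"
proof -
  have reg: "h x \<le> x" if "h \<in> carrier F_monoid" for h :: "'a \<Rightarrow> 'a" and x
    using that by (auto simp: mem_carrier_F_monoid_iff regressive_def)
  have "0 < card (UNIV :: 'a set)" using card by auto
  then obtain o' :: 'a where o: "\<And>z. o' \<le> z"
    using chain_least_outside[OF ch, of "{}"] by auto
  have ho: "h o' = o'" if "h \<in> carrier F_monoid" for h :: "'a \<Rightarrow> 'a"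
    using reg[OF that, of o'] o[of "h o'"] by simp
  show ?thesis
  proof (cases "card (UNIV :: 'a set) = 1")
    case True
    then have "f x = g x" for x by (metis UNIV_I card_1_singletonE singletonD)
    then show ?thesis by auto
  next
    case n1: False
    then have "1 < card (UNIV :: 'a set)" using card by auto
    then obtain a where a: "a \<noteq> o'" "\<And>z. z \<noteq> o' \<Longrightarrow> a \<le> z"
      using chain_least_outside[OF ch, of "{o'}"] by auto
    have ha: "h a = o' \<or> h a = a" if "h \<in> carrier F_monoid" for h :: "'a \<Rightarrow> 'a"
      using reg[OF that, of a] a(2)[of "h a"] by (metis antisym)
    show ?thesis
    proof (cases "card (UNIV :: 'a set) = 2")
      case True
      then have "{o', a} = (UNIV :: 'a set)"
        using a by (intro card_subset_eq) auto
      then have ext: "h = k" if "h o' = k o'" "h a = k a" for h k :: "'a \<Rightarrow> 'a"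
        using that by (metis UNIV_I ext insertE singletonD)
      show ?thesis
        using ha[OF f] ha[OF g] ho[OF f] ho[OF g] by (auto intro: ext)
    next
      case False
      then have n3: "card (UNIV :: 'a set) = 3" using n1 card by auto
      then have "card {o', a} < card (UNIV :: 'a set)" using a by auto
      then obtain b where b: "b \<noteq> o'" "b \<noteq> a" "\<And>z. z \<noteq> o' \<Longrightarrow> z \<noteq> a \<Longrightarrow> b \<le> z"
        using chain_least_outside[OF ch, of "{o', a}"] by auto
      have U: "{o', a, b} = (UNIV :: 'a set)"
        using a b n3 by (intro card_subset_eq) auto
      have ext: "h = k" if "h o' = k o'" "h a = k a" "h b = k b" for h k :: "'a \<Rightarrow> 'a"
      proof (rule HOL.ext)
        fix x
        have "x \<in> {o', a, b}" unfolding U ..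
        then show "h x = k x" using that by auto
      qed
      have lt: "o' < a" "a < b"
        using o a b by (auto simp: order.order_iff_strict)
      have "level b \<le> level a + 1"
        by (rule level_le_Suc_level) (metis a(2) b(3) leD o order.refl)
      then have lev: "level b = level a + 1" "level o' + 1 < level b"
        using level_strict_mono[OF lt(1)] level_strict_mono[OF lt(2)] by auto
      have hb: "h b = o' \<or> h b = a \<or> h b = b" for h :: "'a \<Rightarrow> 'a"
        using U by auto
      \<comment> \<open>Otherwise the neighbours \<open>a\<close> and \<open>b\<close> would have
        images two levels apart.\<close>
      have hab: "h b \<noteq> b" if "h \<in> carrier F_monoid" "h a = o'" for h :: "'a \<Rightarrow> 'a"
      proof -
        have "level (h b) \<le> level (h a) + 1"
          using that(1) lev(1) lt(2) unfolding mem_carrier_F_monoid_iff by blast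
        then show ?thesis using that(2) lev(2) by auto
      qed
      have hba: "h b \<noteq> o'" if "h \<in> carrier F_monoid" "h a = a" for h :: "'a \<Rightarrow> 'a"
        using that lt by (metis leD mem_carrier_F_monoid_iff monoD order.strict_implies_order)
      \<comment> \<open>Only four maps survive: the pair of values at \<open>a\<close> and
        \<open>b\<close> is \<open>(o', o')\<close>, \<open>(o', a)\<close>, \<open>(a, a)\<close>
        or \<open>(a, b)\<close>. In this order, each map fixes the images of all earlier
        ones.\<close>
      have "f b = g b \<and> f a = g a \<or> g (f a) = f a \<and> g (f b) = f b \<or>
          f (g a) = g a \<and> f (g b) = g b"
        using ha[OF f] ha[OF g] ho[OF f] ho[OF g] hb[of f] hb[of g] hab[OF f] hab[OF g]
          hba[OF f] hba[OF g] by metis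
      then show ?thesis
        using ho[OF f] ho[OF g] by (auto intro!: ext)
    qed
  qed
qed

theorem theorem3p8:
  shows "Complete_Partial_Order.chain (\<subseteq>) (X_poset (F_monoid :: ('a::{finite, lattice} \<Rightarrow> 'a) monoid)) \<longleftrightarrow>
    Complete_Partial_Order.chain (\<le>) (UNIV :: 'a set) \<and> card (UNIV :: 'a set) \<in> {1, 2, 3}"
    (is "?lin \<longleftrightarrow> ?ch \<and> ?card")
proof -
  note lin_iff = monoid.chain_X_poset_iff[OF monoid_F_monoid[where ?'a = 'a]]
  have range: "range f \<subseteq> range g" if "f \<in> principal_right F_monoid g" for f g :: "'a \<Rightarrow> 'a"
    using that by (auto simp: mem_principal_right_F_monoid_iff)
  show ?thesis
  proof
    assume ?lin
    then have ch: ?ch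
      using not_chain_imp_incomparable range lin_iff by blast
    moreover have "\<not> 4 \<le> card (UNIV :: 'a set)"
      using \<open>?lin\<close> long_chain_incomparable[OF ch] lin_iff by blast
    moreover have "card (UNIV :: 'a set) \<noteq> 0" by simp
    ultimately show "?ch \<and> ?card" by (simp, linarith)
  next
    assume "?ch \<and> ?card"
    then have absorb: "f = g \<or> g \<circ> f = f \<or> f \<circ> g = g"
      if "f \<in> carrier F_monoid" "g \<in> carrier F_monoid" for f g :: "'a \<Rightarrow> 'a"
      using short_chain_absorb that by blast
    \<comment> \<open>The identity is the right factor in the case \<open>f = g\<close>.\<close>
    have "id \<in> carrier (F_monoid :: ('a \<Rightarrow> 'a) monoid)"
      using monoid.one_closed[OF monoid_F_monoid[where ?'a = 'a]] by (simp add: F_monoid_def)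
    then show ?lin
      unfolding lin_iff mem_principal_right_F_monoid_iff by (metis absorb comp_id)
  qed
qed

end
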